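(* For $s\in(0,\infty)$, let $X_s\sim\mathrm{Poisson}(s)$. Uniformly in $s\in(0,\infty)$ and in $r\ge\sqrt{s}$ with $s+r\in\mathbb{Z}$, $$-\log\mathbb{P}(X_s\ge s+r)\asymp r\,\min\{r/s,1\}\,\log\bigl(\max\{r/s,e\}\bigr),$$ $$\mathbb{P}(X_s\ge s+r)\big/\mathbb{P}(X_s=s+r)\asymp\max\{s/r,1\}.$$ Moreover, uniformly in $s\in(0,\infty)$ and in $r\in[\sqrt{s},s]$ with $s-r\in\mathbb{Z}$, $$-\log\mathbb{P}(X_s\le s-r)\asymp r\,\min\{r/s,1\}\,\log\bigl(\max\{r/s,e\}\bigr),$$ $$\mathbb{P}(X_s\le s-r)\big/\mathbb{P}(X_s=s-r)\asymp\max\{s/r,1\}.$$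
   Context: $a\asymp b$ uniformly over a set of parameters means that there are universal constants $0<c\le C<\infty$ with $cb\le a\le Cb$ for all parameter values in that set. Logarithms are natural. *)

theory Defs
  imports "HOL-Probability.Probability"
begin

text \<open>Two-sided comparability up to constants that do not depend on the parameter value in \<open>A\<close>.\<close>

definition asymp_uniformly_on :: "'a set \<Rightarrow> ('a \<Rightarrow> real) \<Rightarrow> ('a \<Rightarrow> real) \<Rightarrow> bool" where
  "asymp_uniformly_on A f g \<longleftrightarrow>
     (\<exists>c C. 0 < c \<and> c \<le> C \<and> (\<forall>x\<in>A. c * g x \<le> f x \<and> f x \<le> C * g x))"

text \<open>Probability that a Poisson variable with mean \<open>s\<close>, viewed as a real number, lies in \<open>B\<close>.\<close>

definition poisson_prob :: "real \<Rightarrow> real set \<Rightarrow> real" where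
  "poisson_prob s B = measure_pmf.prob (poisson_pmf s) {k. real k \<in> B}"

definition upper_params :: "(real \<times> real) set" where
  "upper_params = {(s, r). 0 < s \<and> sqrt s \<le> r \<and> s + r \<in> \<int>}"

definition lower_params :: "(real \<times> real) set" where
  "lower_params = {(s, r). 0 < s \<and> sqrt s \<le> r \<and> r \<le> s \<and> s - r \<in> \<int>}"

end

theory Submission
  imports Defs
begin

text \<open>
  Write \<open>n = s \<plusminus> r\<close> and let \<open>I = s - n + n ln (n / s)\<close> be the Cramer rate function of the Poisson law.

  Chernoff's bound gives \<open>- ln P \<ge> I\<close> for both tails, and Stirling's upper bound for \<open>n!\<close>
  gives \<open>- ln pmf n \<le> I + 1 + ln n / 2\<close> (\<open>pmf_poisson_ge_rate\<close>). So two things remain: the size of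
  \<open>I\<close>, and the ratio of a tail to its extreme point mass.

  For the size of \<open>I\<close>, the two bounds \<open>(\<surd>n - \<surd>s)\<^sup>2 \<le> I \<le> (n - s)\<^sup>2 / s\<close> hold on both sides of the
  mean and follow from \<open>ln x \<le> x - 1\<close> alone. They settle the range \<open>r \<le> s\<close>, where the target is
  \<open>r\<^sup>2 / s\<close>; for \<open>r > s\<close> the logarithm is read off directly from \<open>n ln (n / s)\<close>.

  For the ratio, quotients of neighbouring point masses are \<open>s / j\<close> with \<open>j\<close> near \<open>n\<close>. Comparison
  with a geometric series bounds the tail by \<open>pmf n\<close> times a multiple of \<open>max (s / r) 1\<close>. In the other
  direction, if \<open>k \<le> s / r\<close> then \<open>k (r + k) / s \<le> 2\<close> because \<open>r\<^sup>2 \<ge> s\<close>; hence the first \<open>s / r\<close>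
  point masses of the tail are all comparable to \<open>pmf n\<close>.

  The ratio matters for the first estimate too. For \<open>r \<le> s\<close> the factor \<open>1 / \<surd>n\<close> from Stirling's formula
  is not bounded below, but multiplied by \<open>s / r\<close> it becomes \<open>\<surd>s / r\<close> up to a constant, and its
  logarithm is absorbed by \<open>r\<^sup>2 / s \<ge> 1\<close>.
\<close>

section \<open>The rate function\<close>

definition poisson_rate :: "real \<Rightarrow> real \<Rightarrow> real" where
  "poisson_rate s x = s - x + x * ln (x / s)"

lemma poisson_rate_le_square:
  assumes "0 < s" "0 \<le> x"
  shows "poisson_rate s x \<le> (x - s)\<^sup>2 / s"
proof (cases "x = 0")
  case False
  with assms have "ln (x / s) \<le> x / s - 1"
    by (intro ln_le_minus_one) simp
  with assms have "x * ln (x / s) \<le> x * (x / s - 1)"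
    by (intro mult_left_mono) auto
  moreover have "s - x + x * (x / s - 1) = (x - s)\<^sup>2 / s"
    using assms by (simp add: field_simps power2_eq_square)
  ultimately show ?thesis by (simp add: poisson_rate_def)
qed (use assms in \<open>simp add: poisson_rate_def power2_eq_square\<close>)

text \<open>Writing \<open>ln (x / s) = 2 ln (\<surd>x / \<surd>s)\<close> before applying \<open>ln y \<ge> 1 - 1 / y\<close> keeps a
  quadratic term, which the same inequality for \<open>y = x / s\<close> would lose.\<close>

lemma poisson_rate_ge_sqrt_diff:
  assumes "0 < s" "0 \<le> x"
  shows "(sqrt x - sqrt s)\<^sup>2 \<le> poisson_rate s x"
proof (cases "x = 0")
  case False
  define a b where "a = sqrt x" and "b = sqrt s"
  have ab: "a > 0" "b > 0" "x = a\<^sup>2" "s = b\<^sup>2"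
    using assms False by (auto simp: a_def b_def)
  have "ln (b / a) \<le> b / a - 1"
    using ab by (intro ln_le_minus_one) simp
  then have "a\<^sup>2 * (2 * ln (a / b)) \<ge> a\<^sup>2 * (2 * (1 - b / a))"
    using ab by (intro mult_left_mono) (auto simp: ln_div)
  moreover
  have "ln (a\<^sup>2 / b\<^sup>2) = 2 * ln (a / b)"
    using ab by (simp add: ln_div ln_realpow)
  then have "a\<^sup>2 * ln (a\<^sup>2 / b\<^sup>2) = a\<^sup>2 * (2 * ln (a / b))" by simp
  moreover have "a\<^sup>2 * (2 * (1 - b / a)) = 2 * a\<^sup>2 - 2 * a * b"
    using ab by (simp add: field_simps power2_eq_square)
  ultimately have "poisson_rate s x \<ge> b\<^sup>2 - a\<^sup>2 + (2 * a\<^sup>2 - 2 * a * b)"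
    unfolding poisson_rate_def ab(3,4) by linarith
  then show ?thesis
    by (simp add: a_def [symmetric] b_def [symmetric] power2_eq_square algebra_simps)
qed (use assms in \<open>simp add: poisson_rate_def\<close>)

lemma poisson_rate_ge_square:
  assumes "0 < s" "0 \<le> x"
  shows "(x - s)\<^sup>2 / (2 * (x + s)) \<le> poisson_rate s x"
proof -
  have "(x - s)\<^sup>2 = (sqrt x - sqrt s)\<^sup>2 * (sqrt x + sqrt s)\<^sup>2"
    using assms by (simp add: power_mult_distrib [symmetric] algebra_simps)
  also have "\<dots> \<le> (sqrt x - sqrt s)\<^sup>2 * (2 * (x + s))"
  proof (rule mult_left_mono)
    have "(sqrt x + sqrt s)\<^sup>2 + (sqrt x - sqrt s)\<^sup>2 = 2 * (x + s)"
      using assms by (simp add: power2_sum power2_diff)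
    then show "(sqrt x + sqrt s)\<^sup>2 \<le> 2 * (x + s)"
      by (smt (verit) zero_le_power2)
  qed simp
  finally have "(x - s)\<^sup>2 / (2 * (x + s)) \<le> (sqrt x - sqrt s)\<^sup>2"
    using assms by (simp add: divide_le_eq)
  also note poisson_rate_ge_sqrt_diff [OF assms]
  finally show ?thesis .
qed

definition tail_exponent :: "real \<Rightarrow> real \<Rightarrow> real" where
  "tail_exponent s r = r * min (r / s) 1 * ln (max (r / s) (exp 1))"

lemma tail_exponent_small:
  assumes "0 < s" "r \<le> s"
  shows "tail_exponent s r = r\<^sup>2 / s"
proof -
  have "r / s \<le> 1" using assms by simp
  moreover have "(1::real) \<le> exp 1" by simp
  ultimately have "min (r / s) 1 = r / s" "max (r / s) (exp 1) = exp 1"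
    by linarith+
  then show ?thesis by (simp add: tail_exponent_def power2_eq_square)
qed

lemma tail_exponent_large:
  assumes "0 < s" "s \<le> r"
  shows "tail_exponent s r = r * ln (max (r / s) (exp 1))"
  using assms by (simp add: tail_exponent_def min_def)

lemma ln_max_exp_ge_one: "1 \<le> ln (max x (exp 1))" for x :: real
  by (subst ln_ge_iff) (auto simp: less_max_iff_disj)

text \<open>For \<open>r > s\<close> the quadratic bound only yields \<open>I \<ge> r / 6\<close>, while \<open>I \<ge> r ln (r / s) - r\<close> is
  useless for moderate \<open>r / s\<close>. The convex combination of the two with weights \<open>6/7\<close> and \<open>1/7\<close>
  cancels the term \<open>- r\<close>; this is where the constant comes from.\<close>

lemma poisson_rate_upper_ge:
  assumes s: "0 < s" and r: "0 < r"
  shows "tail_exponent s r / 7 \<le> poisson_rate s (s + r)"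
proof (cases "r \<le> s")
  case True
  have "r\<^sup>2 / (7 * s) \<le> r\<^sup>2 / (2 * (s + r + s))"
    using True s r by (intro divide_left_mono) auto
  with poisson_rate_ge_square [of s "s + r"] s r True show ?thesis
    by (simp add: tail_exponent_small mult.commute)
next
  case False
  define L where "L = ln (max (r / s) (exp 1))"
  have "r / 6 = r\<^sup>2 / (2 * (r + r + r))"
    using r by (simp add: power2_eq_square)
  also have "\<dots> \<le> r\<^sup>2 / (2 * (s + r + s))"
    using False s r by (intro divide_left_mono) auto
  also have "\<dots> \<le> poisson_rate s (s + r)"
    using poisson_rate_ge_square [of s "s + r"] s r by simp
  finally have quad: "r / 6 \<le> poisson_rate s (s + r)" .
  show ?thesis
  proof (cases "r / s \<le> exp 1")
    case True
    then have "L = 1" by (simp add: L_def max_def)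
    with quad r False s show ?thesis
      by (simp add: tail_exponent_large flip: L_def)
  next
    case big: False
    then have L: "L = ln (r / s)" by (simp add: L_def max_def)
    have "r * ln (r / s) \<le> (s + r) * ln ((s + r) / s)"
      using s r False by (intro mult_mono) (auto simp: field_simps)
    then have "r * L - r \<le> poisson_rate s (s + r)"
      by (simp add: poisson_rate_def L)
    with quad False s show ?thesis
      by (simp add: tail_exponent_large flip: L_def)
  qed
qed

lemma poisson_rate_lower_ge:
  assumes "0 < s" "0 \<le> r" "r \<le> s"
  shows "tail_exponent s r / 7 \<le> poisson_rate s (s - r)"
proof -
  have "r\<^sup>2 / (7 * s) \<le> r\<^sup>2 / (2 * (s - r + s))"
    using assms by (intro divide_left_mono) auto
  with poisson_rate_ge_square [of s "s - r"] assms show ?thesis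
    by (simp add: tail_exponent_small mult.commute)
qed

section \<open>Chernoff's and Stirling's bounds\<close>

lemma prob_pmf_le_if_finite_sums_le:
  fixes p :: "nat pmf"
  assumes "\<And>F. finite F \<Longrightarrow> F \<subseteq> A \<Longrightarrow> sum (pmf p) F \<le> c"
  shows "measure_pmf.prob p A \<le> c"
proof (rule LIMSEQ_le_const2)
  have "incseq (\<lambda>N::nat. A \<inter> {..N})"
    by (auto simp: incseq_def)
  then have "(\<lambda>N. measure_pmf.prob p (A \<inter> {..N})) \<longlonglongrightarrow> measure_pmf.prob p (\<Union>N. A \<inter> {..N})"
    by (intro measure_pmf.finite_Lim_measure_incseq) auto
  also have "(\<Union>N. A \<inter> {..N}) = A" by auto
  finally show "(\<lambda>N. measure_pmf.prob p (A \<inter> {..N})) \<longlonglongrightarrow> measure_pmf.prob p A" .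
  show "\<exists>N. \<forall>n\<ge>N. measure_pmf.prob p (A \<inter> {..n}) \<le> c"
    using assms by (auto simp: measure_measure_pmf_finite)
qed

text \<open>The exponential moment method with the optimal tilt \<open>y = n / s\<close>, covering both tails at once. The
  case \<open>n = 0\<close> is included, through \<open>0 ^ 0 = 1\<close> and \<open>0 * ln 0 = 0\<close>.\<close>

lemma poisson_chernoff:
  assumes s: "0 < s" and tilt: "\<And>k. k \<in> A \<Longrightarrow> (real n / s) ^ n \<le> (real n / s) ^ k"
  shows "measure_pmf.prob (poisson_pmf s) A \<le> exp (- poisson_rate s (real n))"
proof (rule prob_pmf_le_if_finite_sums_le)
  fix F assume F: "finite F" "F \<subseteq> A"
  define y where "y = real n / s"
  have y: "0 \<le> y" "s * y = n" using s by (auto simp: y_def)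
  have yn: "y ^ n = exp (n * ln (n / s))"
    using s by (cases "n = 0") (auto simp: y_def exp_of_nat_mult)
  have "sum (pmf (poisson_pmf s)) F * y ^ n = (\<Sum>k\<in>F. pmf (poisson_pmf s) k * y ^ n)"
    by (simp add: sum_distrib_right)
  also have "\<dots> \<le> (\<Sum>k\<in>F. pmf (poisson_pmf s) k * y ^ k)"
    using F tilt by (intro sum_mono mult_left_mono) (auto simp: y_def simp del: pmf_poisson)
  also have "\<dots> = exp (- s) * (\<Sum>k\<in>F. (s * y) ^ k /\<^sub>R fact k)"
    using s by (simp add: sum_distrib_left field_simps)
  also have "(\<Sum>k\<in>F. (s * y) ^ k /\<^sub>R fact k) \<le> exp (s * y)"
    unfolding exp_def
    by (rule sum_le_suminf) (use F y s summable_exp_generic [of "s * y"] in auto)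
  finally have "sum (pmf (poisson_pmf s)) F * exp (n * ln (n / s)) \<le> exp (n - s)"
    by (simp add: y yn exp_diff exp_minus field_simps)
  then have "sum (pmf (poisson_pmf s)) F \<le> exp (n - s) / exp (n * ln (n / s))"
    by (simp add: field_simps)
  then show "sum (pmf (poisson_pmf s)) F \<le> exp (- poisson_rate s (real n))"
    by (simp add: poisson_rate_def flip: exp_diff)
qed

text \<open>The quotients of the two sides decrease in \<open>n\<close>, by
  \<open>(n + 1/2) ln (1 + 1/n) \<ge> 1\<close>. The maximum with \<open>1\<close> makes the case \<open>n = 0\<close> true.\<close>

lemma ln_fact_le_stirling:
  "ln (fact n) \<le> 1 + ln (max 1 (real n)) / 2 + n * ln (real n) - n"
proof (induction n)
  case (Suc n)
  show ?case
  proof (cases "n = 0")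
    case False
    define x where "x = real n"
    have x: "x \<ge> 1" using False by (simp add: x_def)
    have "2 / (2 * x + 1) \<le> ln (x + 1) - ln x"
      using ln_inverse_approx_ge [of x "x + 1"] x by (simp add: algebra_simps)
    then have "(x + 1 / 2) * (2 / (2 * x + 1)) \<le> (x + 1 / 2) * (ln (x + 1) - ln x)"
      using x by (intro mult_left_mono) auto
    moreover have "(x + 1 / 2) * (2 / (2 * x + 1)) = 1"
      using x by (simp add: field_simps)
    ultimately have step: "1 \<le> (x + 1 / 2) * (ln (x + 1) - ln x)" by (simp only:)
    have "ln (fact (Suc n)) = ln (x + 1) + ln (fact n :: real)"
      using x by (simp add: x_def ln_mult add.commute)
    also have "ln (fact n :: real) \<le> 1 + ln x / 2 + x * ln x - x"
      using Suc.IH x by (simp add: x_def max_def)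
    also have "ln (x + 1) + (1 + ln x / 2 + x * ln x - x)
        \<le> 1 + ln (x + 1) / 2 + (x + 1) * ln (x + 1) - (x + 1)"
      using step by (simp add: algebra_simps)
    finally show ?thesis
      using x by (simp add: x_def max_def add.commute)
  qed simp
qed simp

lemma pmf_poisson_ge_rate:
  assumes s: "0 < s"
  shows "- poisson_rate s n - 1 - ln (max 1 (real n)) / 2 \<le> ln (pmf (poisson_pmf s) n)"
proof -
  have "ln (pmf (poisson_pmf s) n) = n * ln s - ln (fact n) - s"
    using s by (simp add: ln_mult ln_div ln_realpow)
  moreover have "n * ln (n / s) = n * ln n - n * ln s"
    using s by (cases "n = 0") (auto simp: ln_div algebra_simps)
  ultimately show ?thesis
    using ln_fact_le_stirling [of n] by (simp add: poisson_rate_def)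
qed

section \<open>Ratios of point masses\<close>

lemma poisson_pmf_pos: "0 < s \<Longrightarrow> 0 < pmf (poisson_pmf s) n"
  by simp

lemma pmf_poisson_Suc:
  "0 < s \<Longrightarrow> pmf (poisson_pmf s) (Suc n) = pmf (poisson_pmf s) n * (s / (n + 1))"
  by (simp add: field_simps)

lemma pmf_poisson_add_le:
  assumes "0 < s"
  shows "pmf (poisson_pmf s) (n + k) \<le> pmf (poisson_pmf s) n * (s / (n + 1)) ^ k"
proof (induction k)
  case (Suc k)
  have "pmf (poisson_pmf s) (n + Suc k) = pmf (poisson_pmf s) (n + k) * (s / (n + k + 1))"
    using pmf_poisson_Suc [OF assms, of "n + k"] by simp
  also have "\<dots> \<le> (pmf (poisson_pmf s) n * (s / (n + 1)) ^ k) * (s / (n + 1))"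
    using assms Suc.IH by (intro mult_mono divide_left_mono) (auto simp del: pmf_poisson)
  finally show ?case by (simp add: mult_ac del: pmf_poisson)
qed (use assms in simp)

lemma pmf_poisson_add_ge:
  assumes "0 < s"
  shows "pmf (poisson_pmf s) n * (s / (n + k)) ^ k \<le> pmf (poisson_pmf s) (n + k)"
proof -
  have "pmf (poisson_pmf s) n * (s / (n + m)) ^ k \<le> pmf (poisson_pmf s) (n + k)"
    if "k \<le> m" for m
    using that
  proof (induction k)
    case (Suc k)
    have "pmf (poisson_pmf s) n * (s / (n + m)) ^ Suc k
        = (pmf (poisson_pmf s) n * (s / (n + m)) ^ k) * (s / (n + m))"
      by (simp add: mult_ac del: pmf_poisson)
    also have "\<dots> \<le> pmf (poisson_pmf s) (n + k) * (s / (n + k + 1))"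
      using assms Suc by (intro mult_mono divide_left_mono) (auto simp del: pmf_poisson)
    also have "\<dots> = pmf (poisson_pmf s) (n + Suc k)"
      using pmf_poisson_Suc [OF assms, of "n + k"] by simp
    finally show ?case .
  qed simp
  from this [of k] show ?thesis by simp
qed

lemma sum_geometric_le:
  fixes q :: real
  assumes "finite F" "0 \<le> q" "q < 1"
  shows "(\<Sum>k\<in>F. q ^ k) \<le> 1 / (1 - q)"
  using sum_le_suminf [of "\<lambda>k. q ^ k" F] assms by (simp add: summable_geometric suminf_geometric)

text \<open>The injection \<open>h\<close> stands for the distance from the extreme point of a tail, so that the upper
  and the lower tail are treated alike.\<close>

lemma prob_le_geometric:
  fixes p :: "nat pmf"
  assumes decay: "\<And>m. m \<in> A \<Longrightarrow> pmf p m \<le> c * q ^ h m"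
    and inj: "inj_on h A" and q: "0 \<le> q" "q < 1" and c: "0 \<le> c"
  shows "measure_pmf.prob p A \<le> c / (1 - q)"
proof (rule prob_pmf_le_if_finite_sums_le)
  fix F assume F: "finite F" "F \<subseteq> A"
  have "sum (pmf p) F \<le> (\<Sum>m\<in>F. c * q ^ h m)"
    using F decay by (intro sum_mono) auto
  also have "\<dots> = c * (\<Sum>k\<in>h ` F. q ^ k)"
    using F inj by (simp add: sum_distrib_left sum.reindex inj_on_subset)
  also have "\<dots> \<le> c * (1 / (1 - q))"
    using F q c by (intro mult_left_mono sum_geometric_le) auto
  finally show "sum (pmf p) F \<le> c / (1 - q)" by simp
qed

lemma prob_upper_tail_le:
  assumes s: "0 < s" and r: "0 < r" and n: "real n = s + r"
  shows "measure_pmf.prob (poisson_pmf s) {n..} \<le> 2 * max (s / r) 1 * pmf (poisson_pmf s) n"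
proof -
  define q where "q = s / (real n + 1)"
  have q: "0 \<le> q" "q < 1" using s r n by (auto simp: q_def)
  have "measure_pmf.prob (poisson_pmf s) {n..} \<le> pmf (poisson_pmf s) n / (1 - q)"
  proof (rule prob_le_geometric [where h = "\<lambda>m. m - n"])
    show "pmf (poisson_pmf s) m \<le> pmf (poisson_pmf s) n * q ^ (m - n)" if "m \<in> {n..}" for m
      using pmf_poisson_add_le [OF s, of n "m - n"] that by (simp add: q_def add.commute)
  qed (use q in \<open>auto simp: inj_on_def simp del: pmf_poisson\<close>)
  also have "\<dots> = 1 / (1 - q) * pmf (poisson_pmf s) n" by simp
  also have "\<dots> \<le> 2 * max (s / r) 1 * pmf (poisson_pmf s) n"
  proof (rule mult_right_mono)
    have "1 - q = (r + 1) / (s + r + 1)"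
      using s r n by (simp add: q_def field_simps)
    then have "1 / (1 - q) = (s + r + 1) / (r + 1)" by simp
    also have "\<dots> \<le> s / r + 1"
      using s r by (simp add: field_simps)
    also have "\<dots> \<le> 2 * max (s / r) 1" by simp
    finally show "1 / (1 - q) \<le> 2 * max (s / r) 1" .
  qed simp
  finally show ?thesis .
qed

lemma prob_lower_tail_le:
  assumes s: "0 < s" and r: "0 < r" "r \<le> s" and n: "real n = s - r"
  shows "measure_pmf.prob (poisson_pmf s) {..n} \<le> s / r * pmf (poisson_pmf s) n"
proof -
  define q where "q = real n / s"
  have q: "0 \<le> q" "q < 1" using s r n by (auto simp: q_def)
  have "measure_pmf.prob (poisson_pmf s) {..n} \<le> pmf (poisson_pmf s) n / (1 - q)"
  proof (rule prob_le_geometric [where h = "\<lambda>m. n - m"])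
    fix m assume "m \<in> {..n}"
    show "pmf (poisson_pmf s) m \<le> pmf (poisson_pmf s) n * q ^ (n - m)"
    proof (cases "m = n")
      case False
      with \<open>m \<in> {..n}\<close> have m: "m < n" by simp
      then have 1: "pmf (poisson_pmf s) m * (s / n) ^ (n - m) \<le> pmf (poisson_pmf s) n"
        using pmf_poisson_add_ge [OF s, of m "n - m"] by (simp add: of_nat_diff del: pmf_poisson)
      have "(s / n) ^ (n - m) * q ^ (n - m) = 1"
        using m s by (simp add: q_def flip: power_mult_distrib)
      then have "pmf (poisson_pmf s) m = pmf (poisson_pmf s) m * (s / n) ^ (n - m) * q ^ (n - m)"
        by (simp add: mult.assoc del: pmf_poisson)
      also have "\<dots> \<le> pmf (poisson_pmf s) n * q ^ (n - m)"
        using 1 q by (intro mult_right_mono) auto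
      finally show ?thesis .
    qed simp
  qed (use q in \<open>auto simp: inj_on_def simp del: pmf_poisson\<close>)
  also have "1 - q = r / s" using s n by (simp add: q_def field_simps)
  finally show ?thesis by (simp add: mult.commute del: pmf_poisson)
qed

lemma prob_ge_of_many_points:
  fixes p :: "nat pmf" and t c :: real
  assumes "finite B" "B \<subseteq> A" "t \<le> card B" "0 \<le> c" "\<And>m. m \<in> B \<Longrightarrow> c \<le> pmf p m"
  shows "t * c \<le> measure_pmf.prob p A"
proof -
  have "t * c \<le> card B * c" using assms by (intro mult_right_mono) auto
  also have "\<dots> \<le> sum (pmf p) B" using assms by (intro sum_bounded_below) auto
  also have "\<dots> = measure_pmf.prob p B" using assms by (simp add: measure_measure_pmf_finite)
  also have "\<dots> \<le> measure_pmf.prob p A"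
    using assms by (intro measure_pmf.finite_measure_mono) auto
  finally show ?thesis .
qed

lemma prob_ge_pmf: "m \<in> A \<Longrightarrow> pmf p m \<le> measure_pmf.prob p A" for p :: "nat pmf"
  using prob_ge_of_many_points [of "{m}" A 1 "pmf p m" p] by simp

lemma power_one_plus_le_exp:
  fixes x :: real
  assumes "0 \<le> x" "k * x \<le> b"
  shows "(1 + x) ^ k \<le> exp b"
proof -
  have "(1 + x) ^ k \<le> exp x ^ k" using assms by (intro power_mono) auto
  also have "\<dots> = exp (k * x)" by (simp add: exp_of_nat_mult)
  finally show ?thesis using assms by (meson exp_le_cancel_iff order_trans)
qed

text \<open>This is where \<open>r \<ge> \<surd>s\<close> enters: it makes \<open>s / r \<le> r\<close>, hence \<open>k\<^sup>2 \<le> k r \<le> s\<close>. Moving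
  \<open>k\<close> steps away from \<open>s \<plusminus> r\<close> then changes a point mass by a factor of at most about
  \<open>exp (k (r + k) / s)\<close>, which stays bounded.\<close>

lemma window_exponent_le:
  fixes s r k :: real
  assumes "0 < s" "sqrt s \<le> r" "0 \<le> k" "k \<le> s / r"
  shows "k * (r + k) \<le> 2 * s"
proof -
  have r: "0 < r" using assms by (meson less_le_trans real_sqrt_gt_zero)
  have s: "s \<le> r\<^sup>2" using assms r by (simp add: real_le_rsqrt sqrt_le_D)
  have kr: "k * r \<le> s" using assms r by (simp add: field_simps)
  have "s / r \<le> r" using s r by (simp add: field_simps power2_eq_square)
  then have "k \<le> r" using assms by linarith
  then have "k * k \<le> k * r" using assms by (intro mult_left_mono) auto
  with kr show ?thesis by (simp add: algebra_simps)
qed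

lemma prob_upper_tail_ge:
  assumes s: "0 < s" and r: "sqrt s \<le> r" and n: "real n = s + r"
  shows "exp (- 4) * max (s / r) 1 * pmf (poisson_pmf s) n
    \<le> measure_pmf.prob (poisson_pmf s) {n..}"
proof -
  have r0: "0 < r" using s r by (meson less_le_trans real_sqrt_gt_zero)
  define K where "K = nat \<lfloor>s / r\<rfloor>"
  have K: "real K \<le> s / r" "s / r \<le> real K + 1"
    using s r0 by (auto simp: K_def of_nat_nat)
  have "max (s / r) 1 * (exp (- 4) * pmf (poisson_pmf s) n)
      \<le> measure_pmf.prob (poisson_pmf s) {n..}"
  proof (rule prob_ge_of_many_points [where B = "{n..n + K}"])
    show "max (s / r) 1 \<le> card {n..n + K}" using K by auto
    fix m assume m: "m \<in> {n..n + K}"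
    define k where "k = m - n"
    have k: "m = n + k" "k \<le> K" using m by (auto simp: k_def)
    have "real k * (r + real k) \<le> 2 * s"
      using k K by (intro window_exponent_le s r) auto
    then have "real k * ((r + k) / s) \<le> 2"
      using s by (simp add: field_simps)
    then have "(1 + (r + k) / s) ^ k \<le> exp 4"
      using s r0 by (intro power_one_plus_le_exp) auto
    moreover have "1 + (r + k) / s = (n + k) / s"
      using s n by (simp add: field_simps)
    ultimately have e: "((n + k) / s) ^ k \<le> exp 4" by simp
    have "(s / (n + k)) ^ k * ((n + k) / s) ^ k = 1"
      using s r0 n by (simp flip: power_mult_distrib of_nat_add)
    then have "pmf (poisson_pmf s) n
        = pmf (poisson_pmf s) n * (s / (n + k)) ^ k * ((n + k) / s) ^ k"
      by (simp add: mult.assoc del: pmf_poisson)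
    also have "\<dots> \<le> pmf (poisson_pmf s) m * exp 4"
      using pmf_poisson_add_ge [OF s, of n k] e s k
      by (intro mult_mono) (auto simp del: pmf_poisson)
    finally show "exp (- 4) * pmf (poisson_pmf s) n \<le> pmf (poisson_pmf s) m"
      by (simp add: exp_minus field_simps del: pmf_poisson)
  qed auto
  then show ?thesis by (simp add: mult_ac del: pmf_poisson)
qed

text \<open>Below the mean the indices in the window must stay above \<open>s / 2\<close>, which requires \<open>r \<le> s / 4\<close>. For
  larger \<open>r\<close> the factor \<open>s / r\<close> is at most \<open>4 \<le> exp 4\<close>, and the extreme point mass alone suffices.\<close>

lemma prob_lower_tail_ge:
  assumes s: "0 < s" and r: "sqrt s \<le> r" "r \<le> s" and n: "real n = s - r"
  shows "exp (- 4) * (s / r) * pmf (poisson_pmf s) n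
    \<le> measure_pmf.prob (poisson_pmf s) {..n}"
proof (cases "r \<le> s / 4")
  case False
  have r0: "0 < r" using s r by (meson less_le_trans real_sqrt_gt_zero)
  have "s / r \<le> 4" using False r0 by (simp add: field_simps)
  also have "4 \<le> exp (4::real)" using exp_ge_add_one_self [of 4] by linarith
  finally have "exp (- 4) * (s / r) \<le> exp (- 4) * exp 4" by (intro mult_left_mono) auto
  then have "exp (- 4) * (s / r) \<le> 1" by (simp flip: exp_add)
  then have "exp (- 4) * (s / r) * pmf (poisson_pmf s) n \<le> pmf (poisson_pmf s) n"
    by (intro mult_left_le_one_le) (use s r0 in auto)
  also have "\<dots> \<le> measure_pmf.prob (poisson_pmf s) {..n}" by (rule prob_ge_pmf) simp
  finally show ?thesis .
next
  case True
  have r0: "0 < r" using s r by (meson less_le_trans real_sqrt_gt_zero)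
  have "s \<le> r\<^sup>2" using r(1) by (rule sqrt_le_D)
  then have "s / r \<le> r" using r0 by (simp add: field_simps power2_eq_square)
  then have sr: "s / r \<le> s / 4" using True by linarith
  define K where "K = nat \<lfloor>s / r\<rfloor>"
  have K: "real K \<le> s / r" "s / r \<le> real K + 1"
    using s r0 by (auto simp: K_def of_nat_nat)
  have "real K \<le> n" using K sr n True s by linarith
  then have Kn: "K \<le> n" by simp
  have "s / r * (exp (- 4) * pmf (poisson_pmf s) n)
      \<le> measure_pmf.prob (poisson_pmf s) {..n}"
  proof (rule prob_ge_of_many_points [where B = "{n - K..n}"])
    show "s / r \<le> card {n - K..n}" using K Kn by auto
    fix m assume m: "m \<in> {n - K..n}"
    define k where "k = n - m"
    have k: "n = m + k" "k \<le> K" using m by (auto simp: k_def)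
    have "real k \<le> s / 4" using k K sr by linarith
    then have m2: "s / 2 \<le> real m" using n k True by linarith
    have "real k * (r + real k) \<le> 2 * s"
      using k K by (intro window_exponent_le s r) auto
    also have "\<dots> \<le> 4 * real m" using m2 by simp
    finally have "real k * ((r + k) / m) \<le> 4"
      using s m2 by (simp add: field_simps)
    then have "(1 + (r + k) / m) ^ k \<le> exp 4"
      using s r0 by (intro power_one_plus_le_exp) auto
    moreover have "1 + (r + k) / m = s / m"
      using s n k m2 by (simp add: field_simps)
    moreover have "(s / (m + 1)) ^ k \<le> (s / m) ^ k"
      using s m2 by (intro power_mono divide_left_mono) auto
    ultimately have e: "(s / (m + 1)) ^ k \<le> exp 4" by simp
    have "pmf (poisson_pmf s) n \<le> pmf (poisson_pmf s) m * (s / (m + 1)) ^ k"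
      using pmf_poisson_add_le [OF s, of m k] k by simp
    also have "\<dots> \<le> pmf (poisson_pmf s) m * exp 4"
      using e by (intro mult_left_mono) auto
    finally show "exp (- 4) * pmf (poisson_pmf s) n \<le> pmf (poisson_pmf s) m"
      by (simp add: exp_minus field_simps del: pmf_poisson)
  qed auto
  then show ?thesis by (simp add: mult_ac del: pmf_poisson)
qed

section \<open>Upper bounds on the exponents\<close>

text \<open>The factor \<open>s / r\<close> gained over the point mass turns the Stirling loss \<open>ln n / 2\<close>
  into \<open>ln (r\<^sup>2 / s) / 2\<close>, which is at most \<open>r\<^sup>2 / s\<close>.\<close>

lemma neg_ln_prob_le_moderate:
  assumes s: "0 < s" and r: "sqrt s \<le> r" "r \<le> s"
    and n: "(real n - s)\<^sup>2 = r\<^sup>2" "max 1 (real n) \<le> 2 * s"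
    and p: "exp (- 4) * (s / r) * pmf (poisson_pmf s) n \<le> p"
  shows "- ln p \<le> 8 * tail_exponent s r"
proof -
  have r0: "0 < r" using s r by (meson less_le_trans real_sqrt_gt_zero)
  define w where "w = r\<^sup>2 / s"
  have "s \<le> r\<^sup>2" using r(1) by (rule sqrt_le_D)
  then have w: "1 \<le> w" using s by (simp add: w_def)
  have pm: "0 < pmf (poisson_pmf s) n" by (rule poisson_pmf_pos [OF s])
  have "ln (exp (- 4) * (s / r) * pmf (poisson_pmf s) n)
      = - 4 + (ln s - ln r) + ln (pmf (poisson_pmf s) n)"
    using s r0 pm by (simp add: ln_mult ln_div del: pmf_poisson)
  moreover have "ln (exp (- 4) * (s / r) * pmf (poisson_pmf s) n) \<le> ln p"
    using s r0 pm p by (intro ln_mono) (auto simp del: pmf_poisson)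
  ultimately have 1: "- ln p \<le> 4 - ln s + ln r - ln (pmf (poisson_pmf s) n)" by simp
  have 2: "- ln (pmf (poisson_pmf s) n) \<le> poisson_rate s n + 1 + ln (max 1 (real n)) / 2"
    using pmf_poisson_ge_rate [OF s, of n] by simp
  have 3: "poisson_rate s n \<le> w"
    using poisson_rate_le_square [OF s, of "real n"] n by (simp add: w_def)
  have "ln (max 1 (real n)) \<le> ln (2 * s)" using n by (intro ln_mono) auto
  then have 4: "ln (max 1 (real n)) \<le> 1 + ln s"
    using s ln_2_less_1 by (simp add: ln_mult)
  have "ln w = 2 * ln r - ln s" using s r0 by (simp add: w_def ln_div ln_realpow)
  moreover have "ln w \<le> w - 1" using w by (intro ln_le_minus_one) auto
  ultimately have "- ln p \<le> 8 * w" using 1 2 3 4 w by linarith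
  then show ?thesis using s r by (simp add: tail_exponent_small w_def)
qed

text \<open>Beyond \<open>2 s\<close> the Stirling loss \<open>ln n / 2\<close> is at most linear in \<open>r\<close>, so a single point mass suffices.\<close>

lemma neg_ln_prob_le_large:
  assumes s: "0 < s" and r: "s < r" and n: "real n = s + r"
    and p: "pmf (poisson_pmf s) n \<le> p"
  shows "- ln p \<le> 8 * tail_exponent s r"
proof -
  define L where "L = ln (max (r / s) (exp 1))"
  have L: "1 \<le> L" unfolding L_def by (rule ln_max_exp_ge_one)
  have "n \<noteq> 0" using n s r by (intro notI) simp
  then have n1: "1 \<le> real n" by simp
  have rL: "r \<le> r * L" using L s r by simp
  have "ln (pmf (poisson_pmf s) n) \<le> ln p"
    using p poisson_pmf_pos [OF s, of n] by (intro ln_mono)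
  then have 1: "- ln p \<le> poisson_rate s n + 1 + ln (real n) / 2"
    using pmf_poisson_ge_rate [OF s, of n] n1 by (simp add: max_def del: pmf_poisson split: if_splits)
  have "ln (real n) \<le> real n - 1" using n1 by (intro ln_le_minus_one) auto
  then have 2: "1 + ln (real n) / 2 \<le> 2 * r" using n1 n r by linarith
  have "ln (real n / s) \<le> ln (2 * (r / s))"
    using n s r n1 by (intro ln_mono) (auto simp: field_simps)
  also have "\<dots> = ln 2 + ln (r / s)" using s r by (subst ln_mult) auto
  also have "\<dots> \<le> 1 + L"
  proof -
    have "ln (r / s) \<le> L" unfolding L_def using s r by (intro ln_mono) auto
    then show ?thesis using ln_2_less_1 by linarith
  qed
  also have "\<dots> \<le> 2 * L" using L by simp
  finally have "real n * ln (real n / s) \<le> (2 * r) * (2 * L)"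
    using n s r L n1 by (intro mult_mono) auto
  then have 3: "poisson_rate s n \<le> 4 * (r * L)"
    using n s r by (simp add: poisson_rate_def)
  have "- ln p \<le> 8 * (r * L)" using 1 2 3 rL r s by linarith
  then show ?thesis using s r by (simp add: tail_exponent_large L_def)
qed

section \<open>Uniform estimates\<close>

lemma upper_paramsE:
  assumes "(s, r) \<in> upper_params"
  obtains n where "0 < s" "0 < r" "sqrt s \<le> r" "real n = s + r"
    "poisson_prob s {s + r..} = measure_pmf.prob (poisson_pmf s) {n..}"
    "poisson_prob s {s + r} = pmf (poisson_pmf s) n"
proof -
  have s: "0 < s" and r: "sqrt s \<le> r" and int: "s + r \<in> \<int>"
    using assms by (auto simp: upper_params_def)
  have r0: "0 < r" using s r by (meson less_le_trans real_sqrt_gt_zero)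
  have "s + r \<in> \<nat>" using int s r0 by (simp add: Nats_altdef2)
  then obtain n where n: "s + r = real n" by (auto elim: Nats_cases)
  have sets: "{k. real k \<in> {s + r..}} = {n..}" "{k. real k \<in> {s + r}} = {n}" by (auto simp: n)
  show ?thesis
    by (rule that [OF s r0 r n [symmetric]])
      (simp_all only: poisson_prob_def sets measure_pmf_single)
qed

lemma lower_paramsE:
  assumes "(s, r) \<in> lower_params"
  obtains n where "0 < s" "0 < r" "sqrt s \<le> r" "r \<le> s" "real n = s - r"
    "poisson_prob s {..s - r} = measure_pmf.prob (poisson_pmf s) {..n}"
    "poisson_prob s {s - r} = pmf (poisson_pmf s) n"
proof -
  have s: "0 < s" and r: "sqrt s \<le> r" "r \<le> s" and int: "s - r \<in> \<int>"
    using assms by (auto simp: lower_params_def)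
  have r0: "0 < r" using s r by (meson less_le_trans real_sqrt_gt_zero)
  have "s - r \<in> \<nat>" using int r by (simp add: Nats_altdef2)
  then obtain n where n: "s - r = real n" by (auto elim: Nats_cases)
  have sets: "{k. real k \<in> {..s - r}} = {..n}" "{k. real k \<in> {s - r}} = {n}" by (auto simp: n)
  show ?thesis
    by (rule that [OF s r0 r n [symmetric]])
      (simp_all only: poisson_prob_def sets measure_pmf_single)
qed

lemma le_neg_ln_if_le_exp:
  fixes x p :: real
  assumes "0 < p" "p \<le> exp (- x)"
  shows "x \<le> - ln p"
  using ln_mono [OF assms(2,1)] unfolding ln_exp by linarith

lemma asymp_uniformly_onI:
  assumes "0 < c" "c \<le> C"
    and "\<And>s r. (s, r) \<in> A \<Longrightarrow> c * g s r \<le> f s r \<and> f s r \<le> C * g s r"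
  shows "asymp_uniformly_on A (\<lambda>(s, r). f s r) (\<lambda>(s, r). g s r)"
  unfolding asymp_uniformly_on_def
proof (intro exI conjI ballI)
  fix x assume "x \<in> A"
  then show "c * (case x of (s, r) \<Rightarrow> g s r) \<le> (case x of (s, r) \<Rightarrow> f s r)"
    and "(case x of (s, r) \<Rightarrow> f s r) \<le> C * (case x of (s, r) \<Rightarrow> g s r)"
    using assms(3) by (cases x; simp)+
qed fact+

lemma upper_tail_exponent:
  "asymp_uniformly_on upper_params (\<lambda>(s, r). - ln (poisson_prob s {s + r..}))
     (\<lambda>(s, r). tail_exponent s r)"
proof (rule asymp_uniformly_onI [of "1 / 7" 8], simp, simp)
  fix s r assume "(s, r) \<in> upper_params"
  then show "1 / 7 * tail_exponent s r \<le> - ln (poisson_prob s {s + r..})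
      \<and> - ln (poisson_prob s {s + r..}) \<le> 8 * tail_exponent s r"
  proof (cases rule: upper_paramsE)
    case (1 n)
    note [simp del] = pmf_poisson
    let ?P = "measure_pmf.prob (poisson_pmf s) {n..}"
    have pm: "pmf (poisson_pmf s) n \<le> ?P" by (rule prob_ge_pmf) simp
    with poisson_pmf_pos [OF 1(1), of n] have pos: "0 < ?P" by linarith
    have "?P \<le> exp (- poisson_rate s (real n))"
      using 1 by (intro poisson_chernoff power_increasing) auto
    then have "poisson_rate s (real n) \<le> - ln ?P"
      by (rule le_neg_ln_if_le_exp [OF pos])
    then have lo: "1 / 7 * tail_exponent s r \<le> - ln ?P"
      using poisson_rate_upper_ge [of s r] 1 by simp
    have "- ln ?P \<le> 8 * tail_exponent s r"
    proof (cases "r \<le> s")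
      case True
      have "n \<noteq> 0" using 1 by (intro notI) simp
      then have "1 \<le> real n" by simp
      moreover have "max (s / r) 1 = s / r" using True 1 by (simp add: max_def)
      ultimately show ?thesis
        using 1 True prob_upper_tail_ge [of s r n]
        by (intro neg_ln_prob_le_moderate [where n = n]) auto
    next
      case False
      then show ?thesis
        using 1 pm by (intro neg_ln_prob_le_large [where n = n]) auto
    qed
    with lo show ?thesis using 1 by simp
  qed
qed

lemma upper_tail_ratio:
  "asymp_uniformly_on upper_params
     (\<lambda>(s, r). poisson_prob s {s + r..} / poisson_prob s {s + r}) (\<lambda>(s, r). max (s / r) 1)"
proof (rule asymp_uniformly_onI [of "exp (- 4)" 2])
  show "exp (- 4) \<le> (2::real)" by (rule order_trans [of _ 1]) auto
  fix s r assume "(s, r) \<in> upper_params"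
  then show "exp (- 4) * max (s / r) 1 \<le> poisson_prob s {s + r..} / poisson_prob s {s + r}
      \<and> poisson_prob s {s + r..} / poisson_prob s {s + r} \<le> 2 * max (s / r) 1"
  proof (cases rule: upper_paramsE)
    case (1 n)
    then show ?thesis
      using prob_upper_tail_le [of s r n] prob_upper_tail_ge [of s r n] poisson_pmf_pos [of s n]
      by (simp add: pos_le_divide_eq pos_divide_le_eq del: pmf_poisson)
  qed
qed simp

lemma lower_tail_exponent:
  "asymp_uniformly_on lower_params (\<lambda>(s, r). - ln (poisson_prob s {..s - r}))
     (\<lambda>(s, r). tail_exponent s r)"
proof (rule asymp_uniformly_onI [of "1 / 7" 8], simp, simp)
  fix s r assume "(s, r) \<in> lower_params"
  then show "1 / 7 * tail_exponent s r \<le> - ln (poisson_prob s {..s - r})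
      \<and> - ln (poisson_prob s {..s - r}) \<le> 8 * tail_exponent s r"
  proof (cases rule: lower_paramsE)
    case (1 n)
    note [simp del] = pmf_poisson
    let ?P = "measure_pmf.prob (poisson_pmf s) {..n}"
    have pm: "pmf (poisson_pmf s) n \<le> ?P" by (rule prob_ge_pmf) simp
    with poisson_pmf_pos [OF 1(1), of n] have pos: "0 < ?P" by linarith
    have "?P \<le> exp (- poisson_rate s (real n))"
      using 1 by (intro poisson_chernoff power_decreasing) auto
    then have "poisson_rate s (real n) \<le> - ln ?P"
      by (rule le_neg_ln_if_le_exp [OF pos])
    then have lo: "1 / 7 * tail_exponent s r \<le> - ln ?P"
      using poisson_rate_lower_ge [of s r] 1 by simp
    \<comment> \<open>The constraints \<open>\<surd>s \<le> r \<le> s\<close> keep \<open>s\<close> away from \<open>0\<close>.\<close>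
    have "sqrt s * 1 \<le> sqrt s * sqrt s" using 1 by simp
    then have "1 \<le> sqrt s" using 1 by (subst (asm) mult_le_cancel_left_pos) auto
    then have "1 \<le> s" by simp
    then have "- ln ?P \<le> 8 * tail_exponent s r"
      using 1 prob_lower_tail_ge [of s r n]
      by (intro neg_ln_prob_le_moderate [where n = n]) auto
    with lo show ?thesis using 1 by simp
  qed
qed

lemma lower_tail_ratio:
  "asymp_uniformly_on lower_params
     (\<lambda>(s, r). poisson_prob s {..s - r} / poisson_prob s {s - r}) (\<lambda>(s, r). max (s / r) 1)"
proof (rule asymp_uniformly_onI [of "exp (- 4)" 1])
  fix s r assume "(s, r) \<in> lower_params"
  then show "exp (- 4) * max (s / r) 1 \<le> poisson_prob s {..s - r} / poisson_prob s {s - r}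
      \<and> poisson_prob s {..s - r} / poisson_prob s {s - r} \<le> 1 * max (s / r) 1"
  proof (cases rule: lower_paramsE)
    case (1 n)
    then have "max (s / r) 1 = s / r" by (simp add: max_def)
    with 1 show ?thesis
      using prob_lower_tail_le [of s r n] prob_lower_tail_ge [of s r n] poisson_pmf_pos [of s n]
      by (simp add: pos_le_divide_eq pos_divide_le_eq del: pmf_poisson)
  qed
qed auto

theorem propositionC5:
  "asymp_uniformly_on upper_params
           (\<lambda>(s, r). - ln (poisson_prob s {s + r..}))
           (\<lambda>(s, r). r * min (r / s) 1 * ln (max (r / s) (exp 1)))
      \<and> asymp_uniformly_on upper_params
           (\<lambda>(s, r). poisson_prob s {s + r..} / poisson_prob s {s + r})
           (\<lambda>(s, r). max (s / r) 1)
      \<and> asymp_uniformly_on lower_params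
           (\<lambda>(s, r). - ln (poisson_prob s {..s - r}))
           (\<lambda>(s, r). r * min (r / s) 1 * ln (max (r / s) (exp 1)))
      \<and> asymp_uniformly_on lower_params
           (\<lambda>(s, r). poisson_prob s {..s - r} / poisson_prob s {s - r})
           (\<lambda>(s, r). max (s / r) 1)"
  using upper_tail_exponent upper_tail_ratio lower_tail_exponent lower_tail_ratio
  unfolding tail_exponent_def by blast

end
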